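(* Let $T$ be a rooted tree with distinguished set of descent vertices $V_D$, let $\{v_1,\dots,v_m\}$ be the set of its maximal descent vertices, and let $h=h_{v_1}+h_{v_2}+\cdots+h_{v_m}$. Then $d(T;n)$ is a polynomial in $n$ of degree $h$.
   Context: Rooted trees are finite and nonempty. $T$ has vertex set $V$ of size $s$; $p(v)$ is the parent of a non-root vertex $v$. $T$ comes with a distinguished subset $V_D\subseteq V$, whose elements are called descent vertices; all other vertices are ascent vertices. For an integer $n\ge s$, $G(T;n)$ is the rooted tree with $n$ vertices obtained by adding a chain of $n-s$ vertices above the root of $T$ (if $n>s$, the root of $T$ becomes the child of the bottom vertex of the chain and the top of the chain is the root of $G(T;n)$); the added vertices are ascent vertices. A labeling of a rooted tree with $m$ vertices is a bijection $w$ from its vertices to $[m]=\{1,\dots,m\}$, and $\mathrm{Des}(w)$ is the set of non-root vertices $v$ with $w(v)>w(p(v))$. $D(T;n)$ is the set of labelings $w$ of $G(T;n)$ with $\mathrm{Des}(w)=V_D$, and $d(T;n)=|D(T;n)|$, a function of the integer $n\ge s$. For a vertex $v$, $h_v$ is the number of vertices of the subtree of $T$ rooted at $v$ ($v$ together with all its descendants). A descent vertex $v\in V_D$ is maximal if none of its (proper) ancestors is in $V_D$. If $V_D=\emptyset$ then $m=0$ and $h=0$, and a polynomial of degree $0$ means a nonzero constant. *)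

theory Defs
  imports Complex_Main "HOL-Library.FuncSet" "HOL-Computational_Algebra.Polynomial"
begin

text \<open>The value of \<open>parent T\<close> at the root and outside \<open>vertices T\<close> is irrelevant
  and never consulted.\<close>

record 'a rtree =
  vertices :: "'a set"
  root_of :: 'a
  parent :: "'a \<Rightarrow> 'a"

definition parent_rel :: "'a rtree \<Rightarrow> ('a \<times> 'a) set" where
  "parent_rel T = {(v, parent T v) | v. v \<in> vertices T - {root_of T}}"

text \<open>Every vertex is connected to the root by a chain of parents. Since the root has no parent,
  this also excludes cycles.\<close>

definition rooted_tree :: "'a rtree \<Rightarrow> bool" where
  "rooted_tree T \<longleftrightarrow>
     finite (vertices T) \<and> root_of T \<in> vertices T \<and>
     (\<forall>v \<in> vertices T - {root_of T}. parent T v \<in> vertices T) \<and>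
     (\<forall>v \<in> vertices T. (v, root_of T) \<in> (parent_rel T)\<^sup>*)"

definition subtree :: "'a rtree \<Rightarrow> 'a \<Rightarrow> 'a set" where
  "subtree T v = {u \<in> vertices T. (u, v) \<in> (parent_rel T)\<^sup>*}"

definition hook :: "'a rtree \<Rightarrow> 'a \<Rightarrow> nat" where
  "hook T v = card (subtree T v)"

definition maximal_descents :: "'a rtree \<Rightarrow> 'a set \<Rightarrow> 'a set" where
  "maximal_descents T VD = {v \<in> VD. \<forall>u. (v, u) \<in> (parent_rel T)\<^sup>+ \<longrightarrow> u \<notin> VD}"

text \<open>The tree \<open>G(T;n)\<close>, for \<open>n \<ge> s = card (vertices T)\<close>. The vertices of \<open>T\<close> are tagged by
  \<open>Inl\<close>; the added chain is \<open>Inr 0, \<dots>, Inr (n - s - 1)\<close>, listed from bottom to top.\<close>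

definition add_chain :: "'a rtree \<Rightarrow> nat \<Rightarrow> ('a + nat) rtree" where
  "add_chain T n =
     (let k = n - card (vertices T) in
      \<lparr> vertices = Inl ` vertices T \<union> Inr ` {..<k},
        root_of = (if k = 0 then Inl (root_of T) else Inr (k - 1)),
        parent = (\<lambda>x. case x of
                    Inl v \<Rightarrow> (if v = root_of T then Inr 0 else Inl (parent T v))
                  | Inr i \<Rightarrow> Inr (Suc i)) \<rparr>)"

text \<open>Labelings are taken extensional, so that each bijection from the vertices to \<open>{1..m}\<close>
  is counted exactly once.\<close>

definition labelings :: "'a rtree \<Rightarrow> ('a \<Rightarrow> nat) set" where
  "labelings T = {w \<in> extensional (vertices T). bij_betw w (vertices T) {1..card (vertices T)}}"

definition Des :: "'a rtree \<Rightarrow> ('a \<Rightarrow> nat) \<Rightarrow> 'a set" where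
  "Des T w = {v \<in> vertices T - {root_of T}. w v > w (parent T v)}"

definition D_set :: "'a rtree \<Rightarrow> 'a set \<Rightarrow> nat \<Rightarrow> ('a + nat \<Rightarrow> nat) set" where
  "D_set T VD n = {w \<in> labelings (add_chain T n). Des (add_chain T n) w = Inl ` VD}"

definition d_num :: "'a rtree \<Rightarrow> 'a set \<Rightarrow> nat \<Rightarrow> nat" where
  "d_num T VD n = card (D_set T VD n)"

end

theory Submission
  imports Defs "HOL-Library.Infinite_Set"
begin

text \<open>
  The proof is an induction on the number of descent vertices. Let \<open>v\<close> be a maximal descent
  vertex and let \<open>A\<close> be its subtree. The labelings with descent set \<open>V\<^sub>D\<close> together with those with
  descent set \<open>V\<^sub>D - {v}\<close> are the labelings in which nothing is required on the edge above \<open>v\<close>. Such a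
  labeling is a choice of the \<open>\<bar>A\<bar>\<close> labels used on \<open>A\<close> and a labeling of each of the two parts, so
  (\<open>card_descents_cut\<close>)
    \<open>d(T, V\<^sub>D; n) = (n choose \<bar>A\<bar>) * c * d(T - A, V\<^sub>D - A; n - \<bar>A\<bar>) - d(T, V\<^sub>D - {v}; n)\<close>,
  where \<open>c\<close> counts the labelings of \<open>A\<close> with descent set \<open>V\<^sub>D \<inter> A - {v}\<close> and is independent of \<open>n\<close>.
  It is positive, because a tree has a labeling for every choice of directions on its edges
  (\<open>des_labelings_nonempty\<close>).

  The degree \<open>h\<close> is the number of vertices that lie weakly below some descent vertex. In this form
  the degrees are immediate: the vertices below \<open>V\<^sub>D\<close> are those of \<open>A\<close> and those of \<open>T - A\<close> that lie
  below \<open>V\<^sub>D - A\<close>, so the product has degree \<open>h\<close>; and by maximality of \<open>v\<close> fewer vertices, at least \<open>v\<close>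
  being lost, lie below \<open>V\<^sub>D - {v}\<close>, so the subtracted term cannot cancel the leading one. If there
  are no descents, the chain must carry the largest labels in increasing order, and the count is a
  positive constant (\<open>card_no_descents_constant\<close>).

  When \<open>v\<close> is the root of \<open>T\<close>, the rest \<open>T - A\<close> is empty, which is not a tree. The
  induction therefore runs over the sets \<open>W\<close> of vertices of \<open>T\<close> closed under taking parents, the empty
  set included, with the chain attached above.
\<close>

section \<open>Labelings with a prescribed descent set\<close>

text \<open>A forest is given by a vertex set \<open>X\<close> and a map \<open>q\<close> defined on all vertices; the edges are
  the pairs \<open>(x, q x)\<close> with both ends in \<open>X\<close>. Thus \<open>x\<close> is a root exactly if \<open>q x\<close> falls outside \<open>X\<close>,
  and passing to a part of the forest only changes \<open>X\<close>.\<close>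

definition descents_in :: "('b \<Rightarrow> 'b) \<Rightarrow> 'b set \<Rightarrow> ('b \<Rightarrow> nat) \<Rightarrow> 'b set" where
  "descents_in q X w = {x \<in> X. q x \<in> X \<and> w (q x) < w x}"

text \<open>The set \<open>L\<close> of labels is arbitrary because, after a cut, the labels on each part need not be
  an initial segment.\<close>

definition des_labelings ::
    "('b \<Rightarrow> 'b) \<Rightarrow> 'b set \<Rightarrow> nat set \<Rightarrow> 'b set \<Rightarrow> ('b \<Rightarrow> nat) set" where
  "des_labelings q X L D =
     {w \<in> extensional X. bij_betw w X L \<and> descents_in q X w = D}"

lemma descents_in_cong:
  "(\<And>x. x \<in> X \<Longrightarrow> w x = w' x) \<Longrightarrow> descents_in q X w = descents_in q X w'"
  by (auto simp: descents_in_def)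

lemma finite_des_labelings:
  assumes "finite X" "finite L"
  shows "finite (des_labelings q X L D)"
proof (rule finite_subset)
  show "des_labelings q X L D \<subseteq> PiE X (\<lambda>_. L)"
    by (auto simp: des_labelings_def PiE_def dest: bij_betwE)
  show "finite (PiE X (\<lambda>_. L))"
    using assms by (intro finite_PiE) auto
qed

text \<open>Only the relative order of the labels matters: composing with the order isomorphism between
  two label sets of equal size preserves descents.\<close>

lemma card_des_labelings_relabel_le:
  assumes fin: "finite X" "finite L" "finite L'" and card: "card L = card L'"
  shows "card (des_labelings q X L D) \<le> card (des_labelings q X L' D)"
proof -
  obtain g where g: "bij_betw g {..<card L} L" "strict_mono_on {..<card L} g"
    using ex_bij_betw_strict_mono_card[OF fin(2)] by blast
  obtain g' where g': "bij_betw g' {..<card L} L'" "strict_mono_on {..<card L} g'"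
    using ex_bij_betw_strict_mono_card[OF fin(3)] card by metis
  define f where "f = g' \<circ> inv_into {..<card L} g"
  have inv: "bij_betw (inv_into {..<card L} g) L {..<card L}"
    using g(1) by (rule bij_betw_inv_into)
  have f: "bij_betw f L L'"
    unfolding f_def by (rule bij_betw_trans[OF inv g'(1)])
  have mono: "f a < f b" if "a \<in> L" "b \<in> L" "a < b" for a b
  proof -
    have "a \<in> g ` {..<card L}" "b \<in> g ` {..<card L}"
      using g(1) that by (simp_all add: bij_betw_def)
    then obtain i j where i: "i < card L" "a = g i" and j: "j < card L" "b = g j"
      by blast
    have "i < j"
      using strict_mono_onD[OF g(2), of j i] i j that(3)
      by (cases i j rule: linorder_cases) auto
    moreover have "f a = g' i" "f b = g' j"
      using i j g(1) by (auto simp: f_def bij_betw_def inv_into_f_f)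
    ultimately show ?thesis
      using strict_mono_onD[OF g'(2), of i j] i j by auto
  qed
  have iff: "f a < f b \<longleftrightarrow> a < b" if "a \<in> L" "b \<in> L" for a b
    using mono[of a b] mono[of b a] that by (cases a b rule: linorder_cases) auto
  show ?thesis
  proof (rule card_inj_on_le)
    show "inj_on (\<lambda>w. restrict (f \<circ> w) X) (des_labelings q X L D)"
    proof (rule inj_onI)
      fix w u assume wu: "w \<in> des_labelings q X L D" "u \<in> des_labelings q X L D"
        and eq: "restrict (f \<circ> w) X = restrict (f \<circ> u) X"
      have "w x = u x" if "x \<in> X" for x
      proof -
        have "f (w x) = f (u x)"
          using fun_cong[OF eq, of x] that by simp
        moreover have "w x \<in> L" "u x \<in> L"
          using wu that by (auto simp: des_labelings_def dest: bij_betwE)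
        ultimately show ?thesis
          using f by (auto simp: bij_betw_def inj_on_def)
      qed
      then show "w = u"
        using wu by (auto simp: des_labelings_def intro: extensionalityI)
    qed
    show "(\<lambda>w. restrict (f \<circ> w) X) ` des_labelings q X L D \<subseteq> des_labelings q X L' D"
    proof (rule image_subsetI)
      fix w assume w: "w \<in> des_labelings q X L D"
      then have b: "bij_betw w X L" and d: "descents_in q X w = D"
        by (auto simp: des_labelings_def)
      have "bij_betw (restrict (f \<circ> w) X) X L'"
        using bij_betw_trans[OF b f] by (simp add: bij_betw_cong[of X "restrict (f \<circ> w) X" "f \<circ> w"])
      moreover have "descents_in q X (restrict (f \<circ> w) X) = descents_in q X w"
        using bij_betwE[OF b] by (auto simp: descents_in_def iff)
      ultimately show "restrict (f \<circ> w) X \<in> des_labelings q X L' D"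
        using d by (auto simp: des_labelings_def)
    qed
    show "finite (des_labelings q X L' D)"
      using fin by (simp add: finite_des_labelings)
  qed
qed

lemma card_des_labelings_relabel:
  assumes "finite X" "finite L" "finite L'" "card L = card L'"
  shows "card (des_labelings q X L D) = card (des_labelings q X L' D)"
  using assms by (intro antisym card_des_labelings_relabel_le) auto

text \<open>A leaf may be given the largest or the smallest label, whichever produces the required
  comparison with its parent, and the rest is labeled by induction. The rank \<open>\<rho>\<close> excludes cycles, and a
  vertex of largest rank is a leaf.\<close>

lemma des_labelings_nonempty:
  fixes q :: "'b \<Rightarrow> 'b" and \<rho> :: "'b \<Rightarrow> nat"
  assumes "finite X" "finite L" "card L = card X" "D \<subseteq> {x \<in> X. q x \<in> X}"
    and "\<And>x. x \<in> X \<Longrightarrow> q x \<in> X \<Longrightarrow> \<rho> (q x) < \<rho> x"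
  shows "des_labelings q X L D \<noteq> {}"
  using assms
proof (induction "card X" arbitrary: X L D)
  case 0
  then have "X = {}" "L = {}" "D = {}" by auto
  then have "(\<lambda>_. undefined) \<in> des_labelings q X L D"
    by (auto simp: des_labelings_def descents_in_def bij_betw_def)
  then show ?case by blast
next
  case (Suc n)
  have "X \<noteq> {}" using Suc.hyps(2) by auto
  then obtain x where x: "x \<in> X" and max: "\<And>y. y \<in> X \<Longrightarrow> \<rho> y \<le> \<rho> x"
    using obtains_MAX[OF Suc.prems(1), of \<rho>] Suc.prems(1) by (metis Max_ge finite_imageI imageI)
  have leaf: "q y \<noteq> x" if "y \<in> X" for y
    using Suc.prems(5)[of y] max[of y] x that by fastforce
  have L: "L \<noteq> {}" using Suc.prems(3) Suc.hyps(2) by auto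
  define l where "l = (if x \<in> D then Max L else Min L)"
  have l: "l \<in> L" using L Suc.prems(2) by (auto simp: l_def)
  have "des_labelings q (X - {x}) (L - {l}) (D - {x}) \<noteq> {}"
    using Suc.prems Suc.hyps(2) x l leaf by (intro Suc.hyps(1)) auto
  then obtain w where w: "w \<in> extensional (X - {x})" "bij_betw w (X - {x}) (L - {l})"
      "descents_in q (X - {x}) w = D - {x}"
    by (auto simp: des_labelings_def)
  define w' where "w' = w(x := l)"
  have ext: "w' \<in> extensional X"
    using w(1) x by (auto simp: w'_def extensional_def)
  have bij: "bij_betw w' X L"
  proof -
    have "bij_betw w' (X - {x}) (L - {l})"
      using w(2) by (subst bij_betw_cong[of _ _ w]) (auto simp: w'_def)
    then have "bij_betw w' ((X - {x}) \<union> {x}) ((L - {l}) \<union> {l})"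
      by (intro bij_betw_combine) (auto simp: w'_def)
    then show ?thesis using x l by (simp add: insert_absorb)
  qed
  have "y \<in> descents_in q X w' \<longleftrightarrow> y \<in> D" for y
  proof (cases "y = x")
    case True
    show ?thesis
    proof (cases "q x \<in> X")
      case q: True
      then have "w (q x) \<in> L - {l}"
        using w(2) leaf[OF x] by (auto dest: bij_betwE)
      then have "w (q x) \<noteq> l" "Min L \<le> w (q x)" "w (q x) \<le> Max L"
        using Suc.prems(2) by auto
      then have "w (q x) < l \<longleftrightarrow> x \<in> D"
        by (cases "x \<in> D") (simp_all add: l_def)
      then show ?thesis using True q x leaf[OF x] by (simp add: descents_in_def w'_def)
    next
      case False
      then show ?thesis using True Suc.prems(4) by (auto simp: descents_in_def)
    qed
  next
    case False
    then have "y \<in> descents_in q X w' \<longleftrightarrow> y \<in> descents_in q (X - {x}) w"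
      using leaf by (auto simp: descents_in_def w'_def)
    then show ?thesis using w(3) False by auto
  qed
  then have "w' \<in> des_labelings q X L D"
    using ext bij by (auto simp: des_labelings_def)
  then show ?case by blast
qed

text \<open>Without descents, the vertex with the largest label has no parent, so it is the root \<open>t\<close>.
  Removing it, or putting it back, affects nothing else.\<close>

lemma card_des_labelings_remove_top:
  assumes fin: "finite X" and t: "t \<in> X" "q t \<notin> X"
    and up: "\<And>x. x \<in> X \<Longrightarrow> x \<noteq> t \<Longrightarrow> q x \<in> X \<and> q x \<noteq> x"
  shows "card (des_labelings q X {1..card X} {}) =
         card (des_labelings q (X - {t}) {1..card (X - {t})} {})"
proof -
  let ?A = "des_labelings q X {1..card X} {}"
  let ?B = "des_labelings q (X - {t}) {1..card (X - {t})} {}"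
  have cX: "card X = Suc (card (X - {t}))"
    using fin t by (metis card.remove)
  then have ivl: "{1..card X} - {card X} = {1..card (X - {t})}"
    by auto
  have top: "w t = card X" if w: "w \<in> ?A" for w
  proof -
    have b: "bij_betw w X {1..card X}" and d: "descents_in q X w = {}"
      using w by (auto simp: des_labelings_def)
    have "card X \<in> w ` X" using b cX by (auto simp: bij_betw_def)
    then obtain x where x: "x \<in> X" "w x = card X" by auto
    have "x = t"
    proof (rule ccontr)
      assume "x \<noteq> t"
      then have qx: "q x \<in> X" "q x \<noteq> x" using up x by auto
      then have "w (q x) \<ge> w x" using d x by (force simp: descents_in_def)
      moreover have "w (q x) \<le> card X" using b qx by (auto dest: bij_betwE)
      ultimately have "w (q x) = w x" using x by simp
      then show False using b qx x by (auto simp: bij_betw_def inj_on_def)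
    qed
    then show ?thesis using x by simp
  qed
  have "bij_betw (\<lambda>w. restrict w (X - {t})) ?A ?B"
  proof (rule bij_betw_byWitness[where f' = "\<lambda>w. w(t := card X)"])
    show "\<forall>w\<in>?A. (restrict w (X - {t}))(t := card X) = w"
    proof
      fix w assume w: "w \<in> ?A"
      then have "w \<in> extensional X" by (simp add: des_labelings_def)
      then show "(restrict w (X - {t}))(t := card X) = w"
        using top[OF w] by (auto simp: extensional_def fun_eq_iff)
    qed
    show "\<forall>w\<in>?B. restrict (w(t := card X)) (X - {t}) = w"
      by (auto simp: des_labelings_def extensional_def fun_eq_iff)
    show "(\<lambda>w. restrict w (X - {t})) ` ?A \<subseteq> ?B"
    proof (rule image_subsetI)
      fix w assume w: "w \<in> ?A"
      then have b: "bij_betw w X {1..card X}" and d: "descents_in q X w = {}"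
        by (auto simp: des_labelings_def)
      have "bij_betw w (X - {t}) ({1..card X} - {card X})"
      proof (rule bij_betw_DiffI[OF b])
        show "bij_betw w {t} {card X}" using top[OF w] by (simp add: bij_betw_def)
        show "{card X} \<subseteq> {1..card X}" using cX by simp
      qed (use t in simp)
      then have "bij_betw w (X - {t}) {1..card (X - {t})}" by (simp only: ivl)
      moreover have "descents_in q (X - {t}) (restrict w (X - {t})) = {}"
        using d by (auto simp: descents_in_def)
      ultimately show "restrict w (X - {t}) \<in> ?B"
        by (auto simp: des_labelings_def)
    qed
    show "(\<lambda>w. w(t := card X)) ` ?B \<subseteq> ?A"
    proof (rule image_subsetI)
      fix w assume w: "w \<in> ?B"
      then have b: "bij_betw w (X - {t}) {1..card (X - {t})}"
        and d: "descents_in q (X - {t}) w = {}" and e: "w \<in> extensional (X - {t})"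
        by (auto simp: des_labelings_def)
      have "bij_betw (w(t := card X)) (X - {t}) {1..card (X - {t})}"
        using b by (subst bij_betw_cong[of _ _ w]) auto
      then have "bij_betw (w(t := card X)) ((X - {t}) \<union> {t}) ({1..card (X - {t})} \<union> {card X})"
        using cX by (intro bij_betw_combine) auto
      moreover have "{1..card (X - {t})} \<union> {card X} = {1..card X}" using cX by auto
      ultimately have "bij_betw (w(t := card X)) X {1..card X}"
        using t by (simp add: insert_absorb)
      moreover have "\<not> card X < w x" if "x \<in> X" "x \<noteq> t" for x
      proof -
        have "w x \<in> {1..card (X - {t})}" using b that by (auto dest: bij_betwE)
        then show ?thesis using cX by auto
      qed
      then have "descents_in q X (w(t := card X)) = {}"
        using d t by (auto simp: descents_in_def)
      ultimately show "w(t := card X) \<in> ?A"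
        using e t by (auto simp: des_labelings_def extensional_def)
    qed
  qed
  then show ?thesis by (rule bij_betw_same_card)
qed

text \<open>The hypotheses say that the edge above \<open>v\<close> is the only one that may join \<open>A\<close> to the rest.
  The two label counts on the left add up to the labelings with no condition at \<open>v\<close>. The identity
  includes the case that \<open>v\<close> is a root: then no labeling has a descent at \<open>v\<close>, and the first summand is
  zero.\<close>

lemma card_des_labelings_cut:
  assumes fin: "finite X" "finite L" and card: "card L = card X"
    and A: "A \<subseteq> X" "v \<in> A" and D: "v \<in> D" "D \<subseteq> X"
    and into: "\<And>x. x \<in> X - A \<Longrightarrow> q x \<notin> A"
    and out: "\<And>x. x \<in> A \<Longrightarrow> x \<noteq> v \<Longrightarrow> q x \<in> A"
    and qv: "q v \<notin> A"
  shows "card (des_labelings q X L D) + card (des_labelings q X L (D - {v})) =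
    (card X choose card A) * card (des_labelings q A {1..card A} (D \<inter> A - {v}))
      * card (des_labelings q (X - A) {1..card (X - A)} (D - A))"
proof -
  let ?D1 = "D \<inter> A - {v}" and ?D2 = "D - A"
  \<comment> \<open>the labelings with the prescribed comparisons at every vertex other than \<open>v\<close>\<close>
  define C where "C = {w \<in> extensional X. bij_betw w X L \<and> descents_in q X w - {v} = D - {v}}"
  have C_eq: "C = des_labelings q X L D \<union> des_labelings q X L (D - {v})"
    using D by (auto simp: C_def des_labelings_def)
  have card_C: "card C = card (des_labelings q X L D) + card (des_labelings q X L (D - {v}))"
    unfolding C_eq using D fin
    by (intro card_Un_disjoint finite_des_labelings) (auto simp: des_labelings_def)
  have finA: "finite A" using A fin finite_subset by blast
  have split: "descents_in q X w - {v} = descents_in q A w \<union> descents_in q (X - A) w"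
    and sub: "descents_in q A w \<subseteq> A - {v}" "descents_in q (X - A) w \<subseteq> X - A" for w
    using A into out qv by (auto simp: descents_in_def)
  have C_iff: "descents_in q X w - {v} = D - {v} \<longleftrightarrow>
      descents_in q A w = ?D1 \<and> descents_in q (X - A) w = ?D2" for w
    using split[of w] sub[of w] A(2) by auto
  \<comment> \<open>an element of \<open>C\<close> amounts to the set \<open>B\<close> of labels on \<open>A\<close> and a labeling of each part\<close>
  define S where "S = (SIGMA B : {B. B \<subseteq> L \<and> card B = card A}.
      des_labelings q A B ?D1 \<times> des_labelings q (X - A) (L - B) ?D2)"
  have "bij_betw (\<lambda>w. (w ` A, restrict w A, restrict w (X - A))) C S"
  proof (rule bij_betw_byWitness[where f' = "\<lambda>(B, f, g) x. if x \<in> A then f x else g x"])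
    show "\<forall>w\<in>C. (case (w ` A, restrict w A, restrict w (X - A)) of
        (B, f, g) \<Rightarrow> \<lambda>x. if x \<in> A then f x else g x) = w"
      by (auto simp: C_def extensional_def fun_eq_iff)
    show "\<forall>s\<in>S. (\<lambda>w. (w ` A, restrict w A, restrict w (X - A)))
        (case s of (B, f, g) \<Rightarrow> \<lambda>x. if x \<in> A then f x else g x) = s"
      by (auto simp: S_def des_labelings_def extensional_def fun_eq_iff bij_betw_def)
    show "(\<lambda>w. (w ` A, restrict w A, restrict w (X - A))) ` C \<subseteq> S"
    proof (rule image_subsetI)
      fix w assume w: "w \<in> C"
      then have b: "bij_betw w X L"
        and d: "descents_in q A w = ?D1" "descents_in q (X - A) w = ?D2"
        by (simp_all add: C_def C_iff)
      have bA: "bij_betw w A (w ` A)"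
        using b A by (meson bij_betw_def inj_on_subset)
      have wA: "w ` A \<subseteq> L" using b A by (auto simp: bij_betw_def)
      have bB: "bij_betw w (X - A) (L - w ` A)"
        using b A bA wA by (intro bij_betw_DiffI)
      have "descents_in q A (restrict w A) = ?D1"
        "descents_in q (X - A) (restrict w (X - A)) = ?D2"
        using d descents_in_cong[of A "restrict w A" w q]
          descents_in_cong[of "X - A" "restrict w (X - A)" w q] by simp_all
      moreover have "card (w ` A) = card A" using bA by (simp add: bij_betw_same_card)
      ultimately show "(w ` A, restrict w A, restrict w (X - A)) \<in> S"
        using bA bB wA by (simp add: S_def des_labelings_def)
    qed
    show "(\<lambda>(B, f, g) x. if x \<in> A then f x else g x) ` S \<subseteq> C"
    proof (rule image_subsetI)
      fix s assume s: "s \<in> S"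
      obtain B f g where sfg: "s = (B, f, g)" by (cases s) auto
      let ?w = "\<lambda>x. if x \<in> A then f x else g x"
      have B: "B \<subseteq> L"
        and f: "f \<in> extensional A" "bij_betw f A B" "descents_in q A f = ?D1"
        and g: "g \<in> extensional (X - A)" "bij_betw g (X - A) (L - B)"
          "descents_in q (X - A) g = ?D2"
        using s by (auto simp: S_def sfg des_labelings_def)
      have "bij_betw ?w A B" "bij_betw ?w (X - A) (L - B)"
        using bij_betw_cong[of A ?w f B] bij_betw_cong[of "X - A" ?w g "L - B"] f(2) g(2) by simp_all
      then have "bij_betw ?w (A \<union> (X - A)) (B \<union> (L - B))"
        by (intro bij_betw_combine) auto
      moreover have "A \<union> (X - A) = X" "B \<union> (L - B) = L" using A B by auto
      ultimately have b: "bij_betw ?w X L" by simp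
      have "descents_in q A ?w = ?D1" "descents_in q (X - A) ?w = ?D2"
        using f(3) g(3) descents_in_cong[of A ?w f q] descents_in_cong[of "X - A" ?w g q]
        by simp_all
      then have "descents_in q X ?w - {v} = D - {v}" by (simp only: C_iff)
      moreover have "?w \<in> extensional X"
        using f(1) g(1) A by (auto simp: extensional_def)
      ultimately show "(case s of (B, f, g) \<Rightarrow> \<lambda>x. if x \<in> A then f x else g x) \<in> C"
        using b by (simp add: C_def sfg)
    qed
  qed
  then have "card C = card S" by (rule bij_betw_same_card)
  also have "\<dots> = (\<Sum>B | B \<subseteq> L \<and> card B = card A.
      card (des_labelings q A B ?D1 \<times> des_labelings q (X - A) (L - B) ?D2))"
    unfolding S_def
  proof (rule card_SigmaI)
    show "finite {B. B \<subseteq> L \<and> card B = card A}" using fin by simp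
    show "\<forall>B\<in>{B. B \<subseteq> L \<and> card B = card A}.
        finite (des_labelings q A B ?D1 \<times> des_labelings q (X - A) (L - B) ?D2)"
      using fin finA by (auto intro!: finite_cartesian_product finite_des_labelings
          intro: finite_subset)
  qed
  also have "\<dots> = (\<Sum>B | B \<subseteq> L \<and> card B = card A.
      card (des_labelings q A {1..card A} ?D1)
        * card (des_labelings q (X - A) {1..card (X - A)} ?D2))"
  proof (rule sum.cong[OF refl])
    fix B assume "B \<in> {B. B \<subseteq> L \<and> card B = card A}"
    then have B: "B \<subseteq> L" "card B = card A" by auto
    then have finB: "finite B" using fin finite_subset by blast
    have "card (L - B) = card (X - A)"
      using B A fin finA finB card by (simp add: card_Diff_subset)
    then show "card (des_labelings q A B ?D1 \<times> des_labelings q (X - A) (L - B) ?D2) =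
        card (des_labelings q A {1..card A} ?D1)
          * card (des_labelings q (X - A) {1..card (X - A)} ?D2)"
      using B fin finA finB
        card_des_labelings_relabel[of A B "{1..card A}" q ?D1]
        card_des_labelings_relabel[of "X - A" "L - B" "{1..card (X - A)}" q ?D2]
      by (simp add: card_cartesian_product)
  qed
  finally show ?thesis
    using card_C n_subsets[OF fin(2), of "card A"] card by simp
qed

section \<open>The tree and its chain\<close>

text \<open>The rank is the distance to the root. It yields acyclicity, the leaves required by
  \<open>des_labelings_nonempty\<close>, and the existence of maximal descent vertices.\<close>

lemma rooted_tree_rank:
  assumes "rooted_tree T"
  obtains \<rho> :: "'a \<Rightarrow> nat"
  where "\<And>u v. (u, v) \<in> (parent_rel T)\<^sup>+ \<Longrightarrow> \<rho> v < \<rho> u"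
proof
  define \<rho> where "\<rho> v = (LEAST n. (v, root_of T) \<in> parent_rel T ^^ n)" for v
  have step: "\<rho> v < \<rho> u" if "(u, v) \<in> parent_rel T" for u v
  proof -
    from that have u: "u \<in> vertices T" "u \<noteq> root_of T" "v = parent T u"
      by (auto simp: parent_rel_def)
    have "\<exists>n. (u, root_of T) \<in> parent_rel T ^^ n"
      using assms u(1) by (auto simp: rooted_tree_def rtrancl_is_UN_relpow)
    then have n: "(u, root_of T) \<in> parent_rel T ^^ \<rho> u"
      unfolding \<rho>_def by (rule LeastI_ex)
    obtain m where m: "\<rho> u = Suc m"
      using n u(2) by (cases "\<rho> u") auto
    obtain y where y: "(u, y) \<in> parent_rel T" "(y, root_of T) \<in> parent_rel T ^^ m"
      using n unfolding m by (rule relpow_Suc_E2)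
    then have "y = v" using u(3) by (auto simp: parent_rel_def)
    then have "(v, root_of T) \<in> parent_rel T ^^ m" using y by simp
    then have "\<rho> v \<le> m" unfolding \<rho>_def by (rule Least_le)
    then show ?thesis using m by simp
  qed
  show "\<rho> v < \<rho> u" if "(u, v) \<in> (parent_rel T)\<^sup>+" for u v
    using that by (induction rule: trancl_induct) (auto dest: step)
qed

text \<open>This is the parent map of \<open>G(T;n)\<close> for every \<open>n\<close> at once: the length of the chain is decided by
  the vertex set alone, since the top vertex of a chain of length \<open>k\<close> (or the root of \<open>T\<close>, if \<open>k = 0\<close>) is
  mapped to the missing vertex \<open>Inr k\<close>.\<close>

definition extended_parent :: "'a rtree \<Rightarrow> 'a + nat \<Rightarrow> 'a + nat" where
  "extended_parent T x = (case x of
     Inl v \<Rightarrow> (if v = root_of T then Inr 0 else Inl (parent T v))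
   | Inr i \<Rightarrow> Inr (Suc i))"

definition with_chain :: "'a set \<Rightarrow> nat \<Rightarrow> ('a + nat) set" where
  "with_chain W k = Inl ` W \<union> Inr ` {..<k}"

definition ancestor_closed :: "'a rtree \<Rightarrow> 'a set \<Rightarrow> bool" where
  "ancestor_closed T W \<longleftrightarrow>
     W \<subseteq> vertices T \<and> (\<forall>v \<in> W. v \<noteq> root_of T \<longrightarrow> parent T v \<in> W)"

definition below :: "'a rtree \<Rightarrow> 'a set \<Rightarrow> 'a set \<Rightarrow> 'a set" where
  "below T W D = {u \<in> W. \<exists>d \<in> D. (u, d) \<in> (parent_rel T)\<^sup>*}"

lemma finite_with_chain [simp]: "finite W \<Longrightarrow> finite (with_chain W k)"
  by (simp add: with_chain_def)

lemma card_with_chain [simp]: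
  assumes "finite W"
  shows "card (with_chain W k) = card W + k"
  unfolding with_chain_def using assms
  by (subst card_Un_disjoint) (auto simp: card_image)

lemma with_chain_Diff: "with_chain W k - Inl ` A = with_chain (W - A) k"
  by (auto simp: with_chain_def)

text \<open>Pruning a subtree leaves a set of the same kind, so that the induction can continue.\<close>

lemma ancestor_closed_Diff_below:
  assumes "ancestor_closed T W"
  shows "ancestor_closed T (W - below T W {v})"
proof -
  have "parent T u \<notin> below T W {v}"
    if "u \<in> W - below T W {v}" "u \<noteq> root_of T" for u
  proof
    assume "parent T u \<in> below T W {v}"
    moreover have "(u, parent T u) \<in> parent_rel T"
      using that assms by (auto simp: parent_rel_def ancestor_closed_def)
    ultimately have "u \<in> below T W {v}"
      using that by (auto simp: below_def intro: converse_rtrancl_into_rtrancl)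
    then show False using that by simp
  qed
  then show ?thesis using assms by (auto simp: ancestor_closed_def)
qed

text \<open>The additivity of degrees behind the product term of the recursion: whatever lies below a
  descent in \<open>A\<close> is itself in \<open>A\<close>.\<close>

lemma card_below_cut:
  assumes "finite W" "v \<in> D"
  shows "card (below T W D) =
    card (below T W {v}) + card (below T (W - below T W {v}) (D - below T W {v}))"
proof -
  let ?A = "below T W {v}"
  have "below T W D = ?A \<union> below T (W - ?A) (D - ?A)"
  proof (intro equalityI subsetI)
    fix u assume u: "u \<in> below T W D"
    then obtain d where d: "u \<in> W" "d \<in> D" "(u, d) \<in> (parent_rel T)\<^sup>*"
      by (auto simp: below_def)
    show "u \<in> ?A \<union> below T (W - ?A) (D - ?A)"
    proof (cases "u \<in> ?A")
      case False
      then have "d \<notin> ?A" using d by (auto simp: below_def dest: rtrancl_trans)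
      then show ?thesis using d False by (auto simp: below_def)
    qed simp
  qed (use assms in \<open>auto simp: below_def\<close>)
  moreover have "?A \<inter> below T (W - ?A) (D - ?A) = {}" by (auto simp: below_def)
  moreover have "finite (below T U E)" if "finite U" for U E
    using that by (simp add: below_def)
  ultimately show ?thesis using assms by (simp add: card_Un_disjoint)
qed

lemma choose_as_poly:
  obtains Q :: "real poly"
  where "Q \<noteq> 0" "degree Q = a" "\<And>n. poly Q (real n) = real (n choose a)"
proof
  let ?R = "\<Prod>i<a. [:- real i, 1:]"
  let ?Q = "smult (inverse (fact a)) ?R"
  have "degree ?R = (\<Sum>i<a. degree [:- real i, 1:])"
    by (rule degree_prod_eq_sum_degree) auto
  then show "degree ?Q = a" by simp
  show "?Q \<noteq> 0" by (simp add: prod_zero_iff)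
  show "poly ?Q (real n) = real (n choose a)" for n
    by (simp add: poly_prod binomial_gbinomial gbinomial_prod_rev divide_inverse
        atLeast0LessThan mult.commute)
qed

lemma parent_in_parent_rel:
  assumes "ancestor_closed T W" "v \<in> W" "v \<noteq> root_of T"
  shows "(v, parent T v) \<in> parent_rel T" "parent T v \<in> W"
  using assms by (auto simp: parent_rel_def ancestor_closed_def)

text \<open>The subtree \<open>Inl ` A\<close> is considered without the chain; this gives the constant factor \<open>c\<close> of the
  recursion and the constant for \<open>V\<^sub>D = {}\<close> their positivity.\<close>

lemma des_labelings_Inl_nonempty:
  assumes T: "rooted_tree T" and W: "ancestor_closed T W" and AW: "A \<subseteq> W"
    and D: "Inl ` D \<subseteq> {x \<in> Inl ` A. extended_parent T x \<in> Inl ` A}"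
  shows "des_labelings (extended_parent T) (Inl ` A) {1..card A} (Inl ` D) \<noteq> {}"
proof -
  obtain \<rho> :: "'a \<Rightarrow> nat" where \<rho>: "\<And>u v. (u, v) \<in> (parent_rel T)\<^sup>+ \<Longrightarrow> \<rho> v < \<rho> u"
    using rooted_tree_rank[OF T] by blast
  have "finite A"
    using T W AW by (auto simp: rooted_tree_def ancestor_closed_def intro: finite_subset)
  then show ?thesis
  proof (intro des_labelings_nonempty[where \<rho> = "case_sum \<rho> (\<lambda>_. 0)"] D)
    fix x assume x: "x \<in> Inl ` A" "extended_parent T x \<in> Inl ` A"
    then obtain u where u: "x = Inl u" "u \<in> A" by blast
    then have "u \<noteq> root_of T" using x by (auto simp: extended_parent_def)
    then show "case_sum \<rho> (\<lambda>_. 0) (extended_parent T x) < case_sum \<rho> (\<lambda>_. 0) x"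
      using u AW parent_in_parent_rel(1)[OF W, of u] \<rho>[of u "parent T u"]
      by (auto simp: extended_parent_def)
  qed (auto simp: card_image)
qed

text \<open>The top of the chain is peeled off repeatedly. This remains correct for \<open>W = {}\<close>, where the
  chain is all there is.\<close>

lemma card_no_descents_constant:
  assumes "rooted_tree T" and W: "ancestor_closed T W" and fin: "finite W"
  shows "card (des_labelings (extended_parent T) (with_chain W k) {1..card W + k} {}) =
    card (des_labelings (extended_parent T) (with_chain W 0) {1..card W} {})"
proof (induction k)
  case (Suc k)
  obtain \<rho> :: "'a \<Rightarrow> nat" where \<rho>: "\<And>u v. (u, v) \<in> (parent_rel T)\<^sup>+ \<Longrightarrow> \<rho> v < \<rho> u"
    using rooted_tree_rank[OF assms(1)] by blast
  have "with_chain W (Suc k) - {Inr k} = with_chain W k"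
    by (auto simp: with_chain_def less_Suc_eq)
  moreover have "card (des_labelings (extended_parent T) (with_chain W (Suc k))
        {1..card (with_chain W (Suc k))} {}) =
      card (des_labelings (extended_parent T) (with_chain W (Suc k) - {Inr k})
        {1..card (with_chain W (Suc k) - {Inr k})} {})"
  proof (rule card_des_labelings_remove_top)
    fix x assume x: "x \<in> with_chain W (Suc k)" "x \<noteq> Inr k"
    show "extended_parent T x \<in> with_chain W (Suc k) \<and> extended_parent T x \<noteq> x"
    proof (cases x)
      case (Inl v)
      then have "v \<in> W" using x by (auto simp: with_chain_def)
      then have "v \<noteq> root_of T \<Longrightarrow> parent T v \<in> W \<and> parent T v \<noteq> v"
        using parent_in_parent_rel[OF W, of v] \<rho>[of v "parent T v"] by fastforce
      then show ?thesis using Inl by (auto simp: with_chain_def extended_parent_def)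
    next
      case (Inr i)
      then show ?thesis using x by (auto simp: with_chain_def extended_parent_def)
    qed
  qed (use fin in \<open>auto simp: with_chain_def extended_parent_def\<close>)
  ultimately show ?case using Suc fin by simp
qed simp

text \<open>The recursion, written as a sum to avoid subtraction, with the positivity of its constant
  factor.\<close>

lemma card_descents_cut:
  assumes T: "rooted_tree T" and W: "ancestor_closed T W" and D: "D \<subseteq> W" "v \<in> D"
  defines "A \<equiv> below T W {v}"
  shows "card (des_labelings (extended_parent T) (with_chain W k) {1..card W + k} (Inl ` D)) +
      card (des_labelings (extended_parent T) (with_chain W k) {1..card W + k} (Inl ` (D - {v}))) =
    ((card W + k) choose card A) *
      card (des_labelings (extended_parent T) (Inl ` A) {1..card A} (Inl ` (D \<inter> A - {v}))) *
      card (des_labelings (extended_parent T) (with_chain (W - A) k) {1..card (W - A) + k}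
        (Inl ` (D - A)))"
    and "des_labelings (extended_parent T) (Inl ` A) {1..card A} (Inl ` (D \<inter> A - {v})) \<noteq> {}"
proof -
  let ?q = "extended_parent T"
  have fin: "finite W" using T W by (auto simp: rooted_tree_def ancestor_closed_def dest: finite_subset)
  then have finA: "finite A" by (simp add: A_def below_def)
  obtain \<rho> :: "'a \<Rightarrow> nat" where \<rho>: "\<And>u v. (u, v) \<in> (parent_rel T)\<^sup>+ \<Longrightarrow> \<rho> v < \<rho> u"
    using rooted_tree_rank[OF T] by blast
  have vA: "v \<in> A" and AW: "A \<subseteq> W" using D by (auto simp: A_def below_def)
  have into: "?q x \<notin> Inl ` A" if "x \<in> with_chain W k - Inl ` A" for x
  proof (cases x)
    case (Inl u)
    then have u: "u \<in> W - A" using that by (auto simp: with_chain_def)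
    then have "parent T u \<notin> A" if "u \<noteq> root_of T"
      using ancestor_closed_Diff_below[OF W, of v] that by (auto simp: A_def ancestor_closed_def)
    then show ?thesis using Inl by (auto simp: extended_parent_def)
  qed (auto simp: extended_parent_def)
  have out: "?q (Inl u) \<in> Inl ` A" if u: "u \<in> A" "u \<noteq> v" for u
  proof -
    have "(u, v) \<in> (parent_rel T)\<^sup>*" using u by (auto simp: A_def below_def)
    then obtain y where y: "(u, y) \<in> parent_rel T" "(y, v) \<in> (parent_rel T)\<^sup>*"
      using u(2) by (auto elim: converse_rtranclE)
    then have "u \<noteq> root_of T" "y = parent T u" by (auto simp: parent_rel_def)
    moreover have "parent T u \<in> W"
      using parent_in_parent_rel(2)[OF W] u AW \<open>u \<noteq> root_of T\<close> by blast
    ultimately show ?thesis using y by (auto simp: extended_parent_def A_def below_def)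
  qed
  have qv: "?q (Inl v) \<notin> Inl ` A"
  proof (cases "v = root_of T")
    case False
    then have "(v, parent T v) \<in> parent_rel T"
      using parent_in_parent_rel(1)[OF W] D by blast
    moreover have "(v, v) \<notin> (parent_rel T)\<^sup>+" using \<rho>[of v v] by blast
    ultimately have "parent T v \<notin> A"
      by (auto simp: A_def below_def dest: rtrancl_into_trancl2)
    then show ?thesis using False by (auto simp: extended_parent_def)
  qed (auto simp: extended_parent_def)
  have "card (des_labelings ?q (with_chain W k) {1..card W + k} (Inl ` D)) +
      card (des_labelings ?q (with_chain W k) {1..card W + k} (Inl ` D - {Inl v})) =
    (card (with_chain W k) choose card (Inl ` A :: ('a + nat) set)) *
      card (des_labelings ?q (Inl ` A) {1..card (Inl ` A :: ('a + nat) set)}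
        (Inl ` D \<inter> Inl ` A - {Inl v})) *
      card (des_labelings ?q (with_chain W k - Inl ` A) {1..card (with_chain W k - Inl ` A)}
        (Inl ` D - Inl ` A))"
  proof (rule card_des_labelings_cut)
    show "?q x \<in> Inl ` A" if "x \<in> Inl ` A" "x \<noteq> Inl v" for x
      using out that by auto
    show "?q x \<notin> Inl ` A" if "x \<in> with_chain W k - Inl ` A" for x
      using into that .
    show "Inl ` A \<subseteq> with_chain W k" "Inl ` D \<subseteq> with_chain W k"
      using AW D by (auto simp: with_chain_def)
  qed (use fin vA D qv in simp_all)
  moreover have "Inl ` D - {Inl v} = (Inl ` (D - {v}) :: ('a + nat) set)"
    "Inl ` D \<inter> Inl ` A - {Inl v} = (Inl ` (D \<inter> A - {v}) :: ('a + nat) set)"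
    "Inl ` D - Inl ` A = (Inl ` (D - A) :: ('a + nat) set)" by auto
  ultimately show "card (des_labelings ?q (with_chain W k) {1..card W + k} (Inl ` D)) +
      card (des_labelings ?q (with_chain W k) {1..card W + k} (Inl ` (D - {v}))) =
    ((card W + k) choose card A) *
      card (des_labelings ?q (Inl ` A) {1..card A} (Inl ` (D \<inter> A - {v}))) *
      card (des_labelings ?q (with_chain (W - A) k) {1..card (W - A) + k} (Inl ` (D - A)))"
    using fin by (simp add: with_chain_Diff card_image)
  show "des_labelings ?q (Inl ` A) {1..card A} (Inl ` (D \<inter> A - {v})) \<noteq> {}"
    by (rule des_labelings_Inl_nonempty[OF T W AW]) (use out in auto)
qed

section \<open>Polynomiality and degree\<close>

lemma card_descents_poly:
  assumes T: "rooted_tree T" and "ancestor_closed T W" "D \<subseteq> W"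
  shows "\<exists>P :: real poly. P \<noteq> 0 \<and> degree P = card (below T W D) \<and>
    (\<forall>k. real (card (des_labelings (extended_parent T) (with_chain W k) {1..card W + k}
        (Inl ` D))) = poly P (real (card W + k)))"
  using assms(2,3)
proof (induction "card D" arbitrary: W D rule: less_induct)
  case less
  note W = less.prems(1) and D = less.prems(2)
  let ?N = "\<lambda>W D k. card (des_labelings (extended_parent T) (with_chain W k) {1..card W + k}
        (Inl ` D))"
  have fin: "finite W" using T W by (auto simp: rooted_tree_def ancestor_closed_def dest: finite_subset)
  have finD: "finite D" using D fin finite_subset by blast
  obtain \<rho> :: "'a \<Rightarrow> nat" where \<rho>: "\<And>u v. (u, v) \<in> (parent_rel T)\<^sup>+ \<Longrightarrow> \<rho> v < \<rho> u"
    using rooted_tree_rank[OF T] by blast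
  show ?case
  proof (cases "D = {}")
    case True
    let ?c = "card (des_labelings (extended_parent T) (with_chain W 0) {1..card W} {})"
    have "des_labelings (extended_parent T) (with_chain W 0) {1..card W} {} \<noteq> {}"
      using des_labelings_Inl_nonempty[OF T W, of W "{}"] by (simp add: with_chain_def)
    then have c: "?c \<noteq> 0" using fin by (simp add: finite_des_labelings)
    have "below T W {} = {}" by (simp add: below_def)
    then show ?thesis
      using True c card_no_descents_constant[OF T W fin]
      by (intro exI[of _ "[:real ?c:]"]) simp
  next
    case False
    \<comment> \<open>a descent vertex closest to the root has no descent vertex above it\<close>
    obtain v where v: "v \<in> D" and min: "\<And>u. u \<in> D \<Longrightarrow> \<rho> v \<le> \<rho> u"
      using False finD by (metis arg_min_if_finite(1) arg_min_least)
    define A where "A = below T W {v}"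
    let ?c = "card (des_labelings (extended_parent T) (Inl ` A) {1..card A}
        (Inl ` (D \<inter> A - {v})))"
    have AW: "A \<subseteq> W" and vA: "v \<in> A" using v D by (auto simp: A_def below_def)
    have finA: "finite A" using AW fin finite_subset by blast
    have "card (D - {v}) < card D" using v finD by (rule card_Diff1_less[rotated])
    then obtain G :: "real poly" where G: "degree G = card (below T W (D - {v}))"
        "\<And>k. real (?N W (D - {v}) k) = poly G (real (card W + k))"
      using less.hyps[of "D - {v}" W] W D by blast
    have "card (D - A) < card D"
      using v vA finD by (intro psubset_card_mono) auto
    moreover have "ancestor_closed T (W - A)"
      unfolding A_def by (rule ancestor_closed_Diff_below[OF W])
    ultimately obtain F :: "real poly" where F: "F \<noteq> 0"
        "degree F = card (below T (W - A) (D - A))"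
        "\<And>k. real (?N (W - A) (D - A) k) = poly F (real (card (W - A) + k))"
      using less.hyps[of "D - A" "W - A"] D by blast
    obtain Q :: "real poly" where Q: "Q \<noteq> 0" "degree Q = card A"
        "\<And>n. poly Q (real n) = real (n choose card A)"
      by (rule choose_as_poly[of "card A"]) (use that in blast)
    have c: "?c \<noteq> 0"
      using card_descents_cut(2)[OF T W D v] finA
      by (simp add: A_def finite_des_labelings)
    \<comment> \<open>the product term; \<open>F\<close> counts a forest with \<open>card A\<close> fewer vertices, hence the shifted argument\<close>
    define H where "H = smult (real ?c) (Q * (F \<circ>\<^sub>p [:- real (card A), 1:]))"
    have F': "F \<circ>\<^sub>p [:- real (card A), 1:] \<noteq> 0"
      using F(1) by (simp add: pcompose_eq_0_iff)
    have degH: "degree H = card (below T W D)"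
      unfolding H_def using Q F F' c card_below_cut[OF fin v]
      by (simp add: degree_mult_eq degree_pcompose A_def)
    have "v \<notin> below T W (D - {v})"
    proof
      assume "v \<in> below T W (D - {v})"
      then obtain d where d: "d \<in> D" "d \<noteq> v" "(v, d) \<in> (parent_rel T)\<^sup>*"
        by (auto simp: below_def)
      then have "(v, d) \<in> (parent_rel T)\<^sup>+" by (auto simp: rtrancl_eq_or_trancl)
      then show False using \<rho> min[OF d(1)] by fastforce
    qed
    moreover have "v \<in> below T W D" "below T W (D - {v}) \<subseteq> below T W D"
      using v D by (auto simp: below_def)
    ultimately have "below T W (D - {v}) \<subset> below T W D" by blast
    then have deg: "degree G < degree H"
      unfolding degH G(1) using fin by (intro psubset_card_mono) (auto simp: below_def)
    show ?thesis
    proof (intro exI[of _ "H - G"] conjI allI)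
      have "degree (H - G) = degree H"
        using degree_add_eq_left[of "- G" H] deg by simp
      then show "degree (H - G) = card (below T W D)" using degH by simp
      show "H - G \<noteq> 0" using deg by auto
      fix k
      have recursion: "real (?N W D k) + real (?N W (D - {v}) k) =
          real ((card W + k) choose card A) * real ?c * real (?N (W - A) (D - A) k)"
        using arg_cong[OF card_descents_cut(1)[OF T W D v, of k], of real]
        unfolding A_def[symmetric] by (simp only: of_nat_add of_nat_mult)
      have "real (card (W - A) + k) = real (card W + k) - real (card A)"
        using AW finA fin card_mono[OF fin AW] by (simp add: card_Diff_subset of_nat_diff)
      then have "poly H (real (card W + k)) =
          real ?c * (real ((card W + k) choose card A) * real (?N (W - A) (D - A) k))"
        unfolding H_def F(3) Q(3)[symmetric] by (simp add: poly_pcompose add_diff_eq diff_add_eq)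
      then show "real (?N W D k) = poly (H - G) (real (card W + k))"
        using recursion unfolding G(2) poly_diff by (simp only: mult_ac)
    qed
  qed
qed

text \<open>Every descent vertex is below a maximal one, and the subtrees of two maximal descent vertices
  are disjoint: the ancestors of a vertex form a chain, so two with a common descendant are
  comparable.\<close>

lemma card_below_maximal_descents:
  assumes T: "rooted_tree T" and VD: "VD \<subseteq> vertices T"
  shows "card (below T (vertices T) VD) = (\<Sum>v\<in>maximal_descents T VD. hook T v)"
proof -
  obtain \<rho> :: "'a \<Rightarrow> nat" where \<rho>: "\<And>u v. (u, v) \<in> (parent_rel T)\<^sup>+ \<Longrightarrow> \<rho> v < \<rho> u"
    using rooted_tree_rank[OF T] by blast
  let ?M = "maximal_descents T VD"
  have fin: "finite (vertices T)" using T by (simp add: rooted_tree_def)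
  have above: "\<exists>v\<in>?M. (d, v) \<in> (parent_rel T)\<^sup>*" if "d \<in> VD" for d
    using that
  proof (induction "\<rho> d" arbitrary: d rule: less_induct)
    case less
    show ?case
    proof (cases "d \<in> ?M")
      case False
      then obtain e where e: "(d, e) \<in> (parent_rel T)\<^sup>+" "e \<in> VD"
        using less.prems by (auto simp: maximal_descents_def)
      then obtain v where "v \<in> ?M" "(e, v) \<in> (parent_rel T)\<^sup>*"
        using less.hyps[OF \<rho>] by blast
      then show ?thesis using e(1) by (meson rtrancl_trans trancl_into_rtrancl)
    qed blast
  qed
  have "below T (vertices T) VD = (\<Union>v\<in>?M. subtree T v)"
  proof (intro equalityI subsetI)
    fix u assume "u \<in> below T (vertices T) VD"
    then obtain d where d: "u \<in> vertices T" "d \<in> VD" "(u, d) \<in> (parent_rel T)\<^sup>*"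
      by (auto simp: below_def)
    obtain v where "v \<in> ?M" "(d, v) \<in> (parent_rel T)\<^sup>*" using above d(2) by blast
    then show "u \<in> (\<Union>v\<in>?M. subtree T v)"
      using d by (auto simp: subtree_def intro: rtrancl_trans)
  qed (auto simp: below_def subtree_def maximal_descents_def)
  moreover have "single_valued (parent_rel T)"
    by (auto simp: single_valued_def parent_rel_def)
  then have "subtree T v \<inter> subtree T v' = {}" if "v \<in> ?M" "v' \<in> ?M" "v \<noteq> v'" for v v'
    using single_valued_confluent[of "parent_rel T" _ v v'] that
    by (auto simp: subtree_def maximal_descents_def rtrancl_eq_or_trancl)
  moreover have "finite ?M"
    using VD fin by (auto simp: maximal_descents_def intro: finite_subset)
  ultimately show ?thesis
    using fin by (simp add: card_UN_disjoint hook_def subtree_def)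
qed

text \<open>The root of \<open>G(T;n)\<close> is the only vertex whose image under the extended parent map is missing,
  so both notions of descent set agree.\<close>

lemma D_set_eq:
  assumes T: "rooted_tree T" and k: "n = card (vertices T) + k"
  shows "D_set T VD n =
    des_labelings (extended_parent T) (with_chain (vertices T) k) {1..n} (Inl ` VD)"
proof -
  let ?X = "with_chain (vertices T) k"
  have V: "vertices (add_chain T n) = ?X"
    by (simp add: add_chain_def with_chain_def k)
  have p: "parent (add_chain T n) = extended_parent T"
    by (auto simp: add_chain_def Let_def extended_parent_def fun_eq_iff split: sum.splits)
  have fin: "finite (vertices T)" using T by (simp add: rooted_tree_def)
  have root: "x \<noteq> root_of (add_chain T n) \<longleftrightarrow> extended_parent T x \<in> ?X" if "x \<in> ?X" for x
    using that T by (auto simp: add_chain_def Let_def with_chain_def extended_parent_def k rooted_tree_def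
        split: if_splits)
  have "Des (add_chain T n) w = descents_in (extended_parent T) ?X w" for w
    using root by (auto simp: Des_def descents_in_def V p)
  then show ?thesis
    using fin by (auto simp: D_set_def labelings_def des_labelings_def V card_with_chain k[symmetric])
qed

theorem corollary2p2:
  fixes T :: "'a rtree" and VD :: "'a set"
  assumes "rooted_tree T" and "VD \<subseteq> vertices T"
  shows "\<exists>P :: real poly. P \<noteq> 0 \<and>
           degree P = (\<Sum>v\<in>maximal_descents T VD. hook T v) \<and>
           (\<forall>n \<ge> card (vertices T). real (d_num T VD n) = poly P (real n))"
proof -
  have "ancestor_closed T (vertices T)"
    using assms by (auto simp: ancestor_closed_def rooted_tree_def)
  then obtain P :: "real poly" where P: "P \<noteq> 0" "degree P = card (below T (vertices T) VD)"
      "\<And>k. real (card (des_labelings (extended_parent T) (with_chain (vertices T) k)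
          {1..card (vertices T) + k} (Inl ` VD))) = poly P (real (card (vertices T) + k))"
    using card_descents_poly[OF assms(1) _ assms(2)] by blast
  have "real (d_num T VD n) = poly P (real n)" if "n \<ge> card (vertices T)" for n
    using P(3)[of "n - card (vertices T)"] D_set_eq[OF assms(1), of n "n - card (vertices T)" VD] that
    by (simp add: d_num_def)
  then show ?thesis
    using P(1,2) card_below_maximal_descents[OF assms] by auto
qed

end
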